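(* For finite nonempty sets $A,B$, $v\in A$, a planar rooted tree $T$ labelled by $A$ and a planar rooted tree $S$ labelled by $B$, set $$T\diamond_v S=\sum_{f}T\diamond_v^{f}S,$$ where the sum runs over all increasing maps $f:E(T,v)\to Ang^0(S)$. Extended bilinearly, the partial compositions $$\diamond_v:\mathcal{PRT}(A)\otimes\mathcal{PRT}(B)\longrightarrow\mathcal{PRT}\big((A\setminus\{v\})\amalg B\big)$$ define a structure of operad on the species $A\mapsto\mathcal{PRT}(A)$. Its unit is the tree with a single vertex. (This operad is denoted $\mathcal{B}^0$.)
   Context: $K$ is a field of characteristic zero; vector spaces are over $K$. Operads in species form. An operad is a collection of vector spaces $\mathcal{O}(A)$, one for each finite nonempty set $A$, functorial in bijections (relabelling), with linear partial compositions $\circ_v:\mathcal{O}(A)\otimes\mathcal{O}(B)\to\mathcal{O}((A\setminus\{v\})\amalg B)$ for $v\in A$, and a unit element in $\mathcal{O}(\{*\})$ for each one-element set (compatible with relabelling), such that: (nested associativity) $(a\circ_v b)\circ_w c=a\circ_v(b\circ_w c)$ for $a\in\mathcal{O}(A)$, $b\in\mathcal{O}(B)$, $v\in A$, $w\in B$; (disjoint associativity) $(a\circ_v b)\circ_w c=(a\circ_w c)\circ_v b$ for distinct $v,w\in A$; (unit) composing on either side with the unit acts as the identity, up to the evident relabelling; (equivariance) the compositions are compatible with relabelling along bijections. Trees. A planar rooted tree is a rooted tree embedded in the plane, equivalently one in which the children of every vertex are totally ordered from left to right. $B_+(r,T_1\cdots T_k)$ is the tree with root $r$ and branches $T_1,\dots,T_k$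 attached to $r$ from left to right. A tree is labelled by $A$ if it comes with a bijection from its set of vertices onto $A$; $\mathcal{PRT}(A)$ is the vector space spanned by planar rooted trees with $|A|$ vertices labelled by $A$. $E(T,v)$ is the set of edges joining $v$ to its children (incoming edges at $v$), totally ordered from left to right. Angles. An angle of a planar tree $S$ is a pair $(s,\alpha)$ where $s$ is a vertex and $\alpha$ is one of the sectors around $s$ cut out by $S$ in a small disk centred at $s$; a vertex with $k$ children has exactly $k+1$ angles, denoted $(s,0),\dots,(s,k)$ from left to right (to the left of the first child, between consecutive children, to the right of the last child; for the tree with one vertex there is one angle). The set $Ang(S)$ of all angles is totally ordered from left to right: for $S=B_+(r,S_1\cdots S_k)$, the order is $(r,0)<Ang(S_1)<(r,1)<Ang(S_2)<\cdots<Ang(S_k)<(r,k)$, recursively. $Ang^0(S)\subseteq Ang(S)$ is the subset of angles at the root of $S$, with the induced order. "Increasing" means weakly increasing. Substitution. For an increasing map $f:E(T,v)\to Ang(S)$, $T\diamond_v^f S$ is the planar rooted tree labelled by $(A\setminus\{v\})\amalg B$ obtained by replacing the vertex $v$ of $T$ by the tree $S$, plugging each incoming edge $a\in E(T,v)$ (with the branch above it) into the angle $f(a)$ of $S$; edges plugged into the same angle keep their left-to-right order. If $v$ is not the root of $T$, the edge going down from $v$ becomes the edge going down from the root of $S$, at the same position; the root of the new tree is that of $T$ if $v$ is not the root of $T$, and that of $S$ otherwise. *)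

theory Defs
  imports Complex_Main "HOL-Library.Poly_Mapping" "HOL-Library.FuncSet"
begin

section \<open>Operads in species form\<close>

text \<open>
  Labels are taken from a universe \<open>'u\<close>. The disjoint union of \<open>A - {v}\<close> and \<open>B\<close> is the internal
  one: the composition is available whenever \<open>A - {v}\<close> and \<open>B\<close> are disjoint. This makes the two
  associativity laws literal equalities. The intended universes are infinite, so that any
  finite sets have disjoint copies; the type is left unconstrained because no law needs it.
  Note that \<open>v \<in> B\<close> is allowed.
\<close>

definition composable :: "'u set \<Rightarrow> 'u \<Rightarrow> 'u set \<Rightarrow> bool" where
  "composable A v B \<longleftrightarrow>
     finite A \<and> finite B \<and> B \<noteq> {} \<and> v \<in> A \<and> (A - {v}) \<inter> B = {}"

definition glue :: "'u set \<Rightarrow> 'u \<Rightarrow> 'u set \<Rightarrow> 'u set" where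
  "glue A v B = (A - {v}) \<union> B"

text \<open>
  The spaces \<open>Obj A\<close> are subspaces of one ambient vector space (for an abstract species: the
  direct sum of its components). \<open>relabel A \<sigma>\<close> is the action of the bijection
  \<open>\<sigma> : A \<rightarrow> \<sigma> ` A\<close>, and \<open>comp A B v a b\<close> is \<open>a \<circ>\<^sub>v b\<close>; they are meaningful only on the spaces
  \<open>Obj A\<close>, \<open>Obj B\<close>.
\<close>

locale species_operad = vector_space scale
  for scale :: "'k::field \<Rightarrow> 'v::ab_group_add \<Rightarrow> 'v" +
  fixes Obj :: "'u set \<Rightarrow> 'v set"
    and relabel :: "'u set \<Rightarrow> ('u \<Rightarrow> 'u) \<Rightarrow> 'v \<Rightarrow> 'v"
    and comp :: "'u set \<Rightarrow> 'u set \<Rightarrow> 'u \<Rightarrow> 'v \<Rightarrow> 'v \<Rightarrow> 'v"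
    and unit :: "'u \<Rightarrow> 'v"
  assumes Obj_subspace:
    "finite A \<Longrightarrow> A \<noteq> {} \<Longrightarrow> subspace (Obj A)"

    and relabel_closed:
    "finite A \<Longrightarrow> A \<noteq> {} \<Longrightarrow> bij_betw \<sigma> A A' \<Longrightarrow> x \<in> Obj A \<Longrightarrow> relabel A \<sigma> x \<in> Obj A'"
    and relabel_add:
    "finite A \<Longrightarrow> A \<noteq> {} \<Longrightarrow> inj_on \<sigma> A \<Longrightarrow> x \<in> Obj A \<Longrightarrow> y \<in> Obj A \<Longrightarrow>
       relabel A \<sigma> (x + y) = relabel A \<sigma> x + relabel A \<sigma> y"
    and relabel_scale:
    "finite A \<Longrightarrow> A \<noteq> {} \<Longrightarrow> inj_on \<sigma> A \<Longrightarrow> x \<in> Obj A \<Longrightarrow>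
       relabel A \<sigma> (scale k x) = scale k (relabel A \<sigma> x)"
    and relabel_cong:
    "finite A \<Longrightarrow> A \<noteq> {} \<Longrightarrow> inj_on \<sigma> A \<Longrightarrow> (\<And>a. a \<in> A \<Longrightarrow> \<sigma> a = \<tau> a) \<Longrightarrow> x \<in> Obj A \<Longrightarrow>
       relabel A \<sigma> x = relabel A \<tau> x"
    and relabel_id:
    "finite A \<Longrightarrow> A \<noteq> {} \<Longrightarrow> x \<in> Obj A \<Longrightarrow> relabel A id x = x"
    and relabel_comp:
    "finite A \<Longrightarrow> A \<noteq> {} \<Longrightarrow> bij_betw \<sigma> A A' \<Longrightarrow> inj_on \<tau> A' \<Longrightarrow> x \<in> Obj A \<Longrightarrow>
       relabel A (\<tau> \<circ> \<sigma>) x = relabel A' \<tau> (relabel A \<sigma> x)"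

    and comp_closed:
    "composable A v B \<Longrightarrow> a \<in> Obj A \<Longrightarrow> b \<in> Obj B \<Longrightarrow> comp A B v a b \<in> Obj (glue A v B)"
    and comp_add_left:
    "composable A v B \<Longrightarrow> a \<in> Obj A \<Longrightarrow> a' \<in> Obj A \<Longrightarrow> b \<in> Obj B \<Longrightarrow>
       comp A B v (a + a') b = comp A B v a b + comp A B v a' b"
    and comp_add_right:
    "composable A v B \<Longrightarrow> a \<in> Obj A \<Longrightarrow> b \<in> Obj B \<Longrightarrow> b' \<in> Obj B \<Longrightarrow>
       comp A B v a (b + b') = comp A B v a b + comp A B v a b'"
    and comp_scale_left:
    "composable A v B \<Longrightarrow> a \<in> Obj A \<Longrightarrow> b \<in> Obj B \<Longrightarrow>
       comp A B v (scale k a) b = scale k (comp A B v a b)"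
    and comp_scale_right:
    "composable A v B \<Longrightarrow> a \<in> Obj A \<Longrightarrow> b \<in> Obj B \<Longrightarrow>
       comp A B v a (scale k b) = scale k (comp A B v a b)"

    and nested_assoc:
    "composable A v B \<Longrightarrow> w \<in> B \<Longrightarrow> composable (glue A v B) w C \<Longrightarrow>
       a \<in> Obj A \<Longrightarrow> b \<in> Obj B \<Longrightarrow> c \<in> Obj C \<Longrightarrow>
       comp (glue A v B) C w (comp A B v a b) c = comp A (glue B w C) v a (comp B C w b c)"
    and disjoint_assoc:
    "composable A v B \<Longrightarrow> composable A w C \<Longrightarrow> v \<noteq> w \<Longrightarrow> B \<inter> C = {} \<Longrightarrow>
       a \<in> Obj A \<Longrightarrow> b \<in> Obj B \<Longrightarrow> c \<in> Obj C \<Longrightarrow>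
       comp (glue A v B) C w (comp A B v a b) c = comp (glue A w C) B v (comp A C w a c) b"

    and unit_closed: "unit u \<in> Obj {u}"
    and unit_relabel: "relabel {u} \<sigma> (unit u) = unit (\<sigma> u)"
    and unit_left:
    "finite B \<Longrightarrow> B \<noteq> {} \<Longrightarrow> b \<in> Obj B \<Longrightarrow> comp {v} B v (unit v) b = b"
    and unit_right:
    "composable A v {w} \<Longrightarrow> a \<in> Obj A \<Longrightarrow> comp A {w} v a (unit w) = relabel A (id(v := w)) a"

    and comp_equivariant:
    "composable A v B \<Longrightarrow> bij_betw \<sigma> A A' \<Longrightarrow> bij_betw \<tau> B B' \<Longrightarrow> composable A' (\<sigma> v) B' \<Longrightarrow>
       a \<in> Obj A \<Longrightarrow> b \<in> Obj B \<Longrightarrow>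
       comp A' B' (\<sigma> v) (relabel A \<sigma> a) (relabel B \<tau> b) =
       relabel (glue A v B) (\<lambda>x. if x \<in> B then \<tau> x else \<sigma> x) (comp A B v a b)"

section \<open>Labelled planar rooted trees\<close>

text \<open>\<open>B_plus r [T\<^sub>1, \<dots>, T\<^sub>k]\<close>: the branches are listed from left to right.\<close>

datatype 'u prt = B_plus (root: 'u) (branches: "'u prt list")

primrec vertices :: "'u prt \<Rightarrow> 'u list" where
  "vertices (B_plus r Ts) = r # concat (map vertices Ts)"

definition labelled_by :: "'u prt \<Rightarrow> 'u set \<Rightarrow> bool" where
  "labelled_by T A \<longleftrightarrow> distinct (vertices T) \<and> set (vertices T) = A"

primrec num_children :: "'u prt \<Rightarrow> 'u \<Rightarrow> nat" where
  "num_children (B_plus r Ts) v =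
     (if v = r then length Ts else sum_list (map (\<lambda>T. num_children T v) Ts))"

text \<open>The incoming edges at \<open>v\<close> are represented by their positions, counted from the left.\<close>

definition in_edges :: "'u prt \<Rightarrow> 'u \<Rightarrow> nat set" where
  "in_edges T v = {..<num_children T v}"

section \<open>Angles\<close>

text \<open>All angles of a tree, listed from left to right.\<close>

primrec angles :: "'u prt \<Rightarrow> ('u \<times> nat) list" where
  "angles (B_plus r Ss) =
     concat (map2 (\<lambda>i as. (r, i) # as) [0..<length Ss] (map angles Ss)) @ [(r, length Ss)]"

definition Ang :: "'u prt \<Rightarrow> ('u \<times> nat) set" where
  "Ang S = set (angles S)"

definition Ang0 :: "'u prt \<Rightarrow> ('u \<times> nat) set" where
  "Ang0 S = {x \<in> Ang S. fst x = root S}"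

definition angle_le :: "'u prt \<Rightarrow> 'u \<times> nat \<Rightarrow> 'u \<times> nat \<Rightarrow> bool" where
  "angle_le S x y \<longleftrightarrow>
     (\<exists>i j. i \<le> j \<and> j < length (angles S) \<and> angles S ! i = x \<and> angles S ! j = y)"

section \<open>Substitution\<close>

text \<open>\<open>graft g S\<close> plugs the list of trees \<open>g x\<close> into each angle \<open>x\<close> of \<open>S\<close>.\<close>

primrec graft :: "('u \<times> nat \<Rightarrow> 'u prt list) \<Rightarrow> 'u prt \<Rightarrow> 'u prt" where
  "graft g (B_plus r Ss) =
     B_plus r (concat (map2 (\<lambda>i S. g (r, i) @ [S]) [0..<length Ss] (map (graft g) Ss))
               @ g (r, length Ss))"

text \<open>\<open>subst_tree v f S T\<close> is \<open>T \<diamond>\<^sub>v\<^sup>f S\<close>.\<close>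

primrec subst_tree :: "'u \<Rightarrow> (nat \<Rightarrow> 'u \<times> nat) \<Rightarrow> 'u prt \<Rightarrow> 'u prt \<Rightarrow> 'u prt" where
  "subst_tree v f S (B_plus r Ts) =
     (if r = v
      then graft (\<lambda>x. map (\<lambda>i. Ts ! i) (filter (\<lambda>i. f i = x) [0..<length Ts])) S
      else B_plus r (map (subst_tree v f S) Ts))"

definition incr_maps ::
    "'u prt \<Rightarrow> 'u \<Rightarrow> 'u prt \<Rightarrow> ('u \<times> nat) set \<Rightarrow> (nat \<Rightarrow> 'u \<times> nat) set" where
  "incr_maps T v S X = {f \<in> in_edges T v \<rightarrow>\<^sub>E X. monotone_on (in_edges T v) (\<le>) (angle_le S) f}"

section \<open>The species of planar rooted trees\<close>

text \<open>Formal linear combinations are finitely supported functions on trees.\<close>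

definition pscale :: "'k::field \<Rightarrow> ('t \<Rightarrow>\<^sub>0 'k) \<Rightarrow> ('t \<Rightarrow>\<^sub>0 'k)" where
  "pscale c x = Poly_Mapping.map (\<lambda>y. c * y) x"

definition PRT :: "'u set \<Rightarrow> ('u prt \<Rightarrow>\<^sub>0 'k::field) set" where
  "PRT A = {x. \<forall>T \<in> Poly_Mapping.keys x. labelled_by T A}"

definition relabel_PRT ::
    "'u set \<Rightarrow> ('u \<Rightarrow> 'u) \<Rightarrow> ('u prt \<Rightarrow>\<^sub>0 'k::field) \<Rightarrow> ('u prt \<Rightarrow>\<^sub>0 'k)" where
  "relabel_PRT A \<sigma> x =
     (\<Sum>T \<in> Poly_Mapping.keys x. Poly_Mapping.single (map_prt \<sigma> T) (Poly_Mapping.lookup x T))"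

definition diamond0_tree :: "'u \<Rightarrow> 'u prt \<Rightarrow> 'u prt \<Rightarrow> ('u prt \<Rightarrow>\<^sub>0 'k::field)" where
  "diamond0_tree v T S =
     (\<Sum>f \<in> incr_maps T v S (Ang0 S). Poly_Mapping.single (subst_tree v f S T) 1)"

definition diamond0 ::
    "'u set \<Rightarrow> 'u set \<Rightarrow> 'u \<Rightarrow> ('u prt \<Rightarrow>\<^sub>0 'k::field) \<Rightarrow> ('u prt \<Rightarrow>\<^sub>0 'k) \<Rightarrow> ('u prt \<Rightarrow>\<^sub>0 'k)" where
  "diamond0 A B v x y =
     (\<Sum>T \<in> Poly_Mapping.keys x. \<Sum>S \<in> Poly_Mapping.keys y.
        pscale (Poly_Mapping.lookup x T * Poly_Mapping.lookup y S) (diamond0_tree v T S))"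

definition single_vertex :: "'u \<Rightarrow> ('u prt \<Rightarrow>\<^sub>0 'k::field)" where
  "single_vertex x = Poly_Mapping.single (B_plus x []) 1"

end

theory Submission
  imports Defs "HOL-Library.Multiset"
begin

text \<open>
  An increasing map from the incoming edges at \<open>v\<close> to the root angles of \<open>S\<close> is the same as a
  shuffle of the branches at \<open>v\<close> with the branches at the root of \<open>S\<close>. So \<open>T \<diamond>\<^sub>v S\<close> merges \<open>v\<close>
  with the root of \<open>S\<close> and sums over all shuffles of the two lists of branches. Nested
  associativity at the root of \<open>S\<close> is associativity of shuffling; everywhere else the
  associativity laws say that substitutions at different vertices commute.

  A formal sum of trees (or of lists) is represented by the functional that sums a given
  function \<open>\<phi>\<close> over its terms. Composites of formal sums are then nested functionals, and
  exchanging two of them only needs that the outer one is additive in \<open>\<phi>\<close>.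
\<close>

section \<open>Sums over shuffles\<close>

text \<open>The shuffle product of words, paired with \<phi>. Each shuffle is a term of its own: a
  sum over the set of resulting lists would lose multiplicities when entries coincide.\<close>

fun shuffle_sum :: "('a list \<Rightarrow> 'm::comm_monoid_add) \<Rightarrow> 'a list \<Rightarrow> 'a list \<Rightarrow> 'm" where
  "shuffle_sum \<phi> [] ys = \<phi> ys"
| "shuffle_sum \<phi> (x # xs) [] = \<phi> (x # xs)"
| "shuffle_sum \<phi> (x # xs) (y # ys) =
     shuffle_sum (\<lambda>zs. \<phi> (x # zs)) xs (y # ys) + shuffle_sum (\<lambda>zs. \<phi> (y # zs)) (x # xs) ys"

lemma shuffle_sum_Nil1 [simp]: "shuffle_sum \<phi> [] = \<phi>"
  by (rule ext) simp

lemma shuffle_sum_Nil2 [simp]: "shuffle_sum \<phi> xs [] = \<phi> xs"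
  by (cases xs) auto

text \<open>Binary additivity is the right notion here: a shuffle sum always has at least one term,
  so zero never has to be preserved.\<close>

definition additive_functional :: "(('a \<Rightarrow> 'm::comm_monoid_add) \<Rightarrow> 'n::comm_monoid_add) \<Rightarrow> bool" where
  "additive_functional L \<longleftrightarrow> (\<forall>\<phi> \<psi>. L (\<lambda>x. \<phi> x + \<psi> x) = L \<phi> + L \<psi>)"

lemma additive_functionalD:
  "additive_functional L \<Longrightarrow> L (\<lambda>x. \<phi> x + \<psi> x) = L \<phi> + L \<psi>"
  by (simp add: additive_functional_def)

lemma shuffle_sum_add:
  "shuffle_sum (\<lambda>zs. \<phi> zs + \<psi> zs) xs ys = shuffle_sum \<phi> xs ys + shuffle_sum \<psi> xs ys"
proof (induction \<phi> xs ys arbitrary: \<psi> rule: shuffle_sum.induct)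
  case (3 \<phi> x xs y ys)
  then show ?case
    by (simp only: shuffle_sum.simps) (simp only: ac_simps)
qed simp_all

text \<open>Interchange of two finite sums. The recursion for shuffles only ever adds two values,
  and \<open>L\<close> respects that.\<close>

lemma shuffle_sum_swap:
  assumes "additive_functional L"
  shows "shuffle_sum (\<lambda>zs. L (\<phi> zs)) xs ys = L (\<lambda>x. shuffle_sum (\<lambda>zs. \<phi> zs x) xs ys)"
proof -
  have "\<forall>\<phi>. shuffle_sum (\<lambda>zs. L (\<phi> zs)) xs ys = L (\<lambda>x. shuffle_sum (\<lambda>zs. \<phi> zs x) xs ys)"
  proof (induction "length xs + length ys" arbitrary: xs ys rule: less_induct)
    case less
    show ?case
    proof (cases xs; cases ys)
      fix x xs' y ys' assume "xs = x # xs'" "ys = y # ys'"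
      with less show ?thesis by (simp add: additive_functionalD[OF assms])
    qed auto
  qed
  then show ?thesis by blast
qed

lemma shuffle_sum_map:
  "shuffle_sum \<phi> (map h xs) (map h ys) = shuffle_sum (\<lambda>zs. \<phi> (map h zs)) xs ys"
  by (induction "\<lambda>zs. \<phi> (map h zs)" xs ys arbitrary: \<phi> rule: shuffle_sum.induct) auto

text \<open>Both sides run over the shuffles of three lists. Sorting these by the list that supplies
  the first letter gives three shorter instances, hence the induction on the total length.\<close>

lemma shuffle_sum_assoc:
  "shuffle_sum (\<lambda>us. shuffle_sum \<phi> us zs) xs ys = shuffle_sum (shuffle_sum \<phi> xs) ys zs"
proof (induction "length xs + length ys + length zs" arbitrary: xs ys zs \<phi> rule: less_induct)
  case less
  show ?case
  proof (cases "xs = [] \<or> ys = [] \<or> zs = []")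
    case True
    then show ?thesis by auto
  next
    case False
    then obtain x xs' y ys' z zs' where eq: "xs = x # xs'" "ys = y # ys'" "zs = z # zs'"
      by (meson neq_Nil_conv)
    let ?\<phi> = "\<lambda>x us. \<phi> (x # us)"
    \<comment> \<open>The three summands collect the shuffles that start with \<open>x\<close>,
      \<open>y\<close> and \<open>z\<close>.\<close>
    have "shuffle_sum (\<lambda>us. shuffle_sum \<phi> us zs) xs ys =
        shuffle_sum (\<lambda>us. shuffle_sum (?\<phi> x) us zs) xs' ys +
        shuffle_sum (\<lambda>us. shuffle_sum (?\<phi> y) us zs) xs ys' +
        shuffle_sum (\<lambda>us. shuffle_sum (?\<phi> z) us zs') xs ys"
      by (simp add: eq shuffle_sum_add algebra_simps)
    also have "\<dots> = shuffle_sum (shuffle_sum (?\<phi> x) xs') ys zs +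
        shuffle_sum (shuffle_sum (?\<phi> y) xs) ys' zs +
        shuffle_sum (shuffle_sum (?\<phi> z) xs) ys zs'"
      using less[of xs' ys zs "?\<phi> x"] less[of xs ys' zs "?\<phi> y"] less[of xs ys zs' "?\<phi> z"]
      by (simp only: eq) simp
    also have "\<dots> = shuffle_sum (shuffle_sum \<phi> xs) ys zs"
      by (simp add: eq shuffle_sum_add algebra_simps)
    finally show ?thesis .
  qed
qed

text \<open>The tensor product of formal sums: one term is chosen from each, and \<phi> is applied
  to the list of choices. It describes substitution carried out in all branches of a vertex at
  once.\<close>

primrec sequence_sum :: "(('a \<Rightarrow> 'm) \<Rightarrow> 'm) list \<Rightarrow> ('a list \<Rightarrow> 'm) \<Rightarrow> 'm" where
  "sequence_sum [] \<phi> = \<phi> []"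
| "sequence_sum (L # Ls) \<phi> = L (\<lambda>x. sequence_sum Ls (\<lambda>xs. \<phi> (x # xs)))"

lemma additive_sequence_sum:
  "(\<And>L. L \<in> set Ls \<Longrightarrow> additive_functional L) \<Longrightarrow> additive_functional (sequence_sum Ls)"
  by (induction Ls) (auto simp: additive_functional_def)

text \<open>\<open>I\<close> and \<open>J\<close> stand for one polymorphic functional at two value
  types, because \<open>L\<close> may change the type of the values.\<close>

lemma sequence_sum_swap:
  assumes "\<And>x \<phi>. x \<in> set xs \<Longrightarrow> I x (\<lambda>u. L (\<phi> u)) = L (\<lambda>y. J x (\<lambda>u. \<phi> u y))"
  shows "sequence_sum (map I xs) (\<lambda>us. L (\<phi> us)) = L (\<lambda>y. sequence_sum (map J xs) (\<lambda>us. \<phi> us y))"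
  using assms by (induction xs arbitrary: \<phi>) auto

text \<open>A shuffle rearranges entries without looking at them, so expanding every entry into a
  formal sum can be done before or after shuffling. Only the order of summation changes, which is
  what \<open>swap\<close> allows.\<close>

lemma shuffle_sum_sequence_sum:
  fixes I :: "'a \<Rightarrow> ('a \<Rightarrow> 'm::comm_monoid_add) \<Rightarrow> 'm"
  assumes add: "\<And>x. additive_functional (I x)"
    and swap: "\<And>x (L :: ('a \<Rightarrow> 'm) \<Rightarrow> 'm) \<phi>. additive_functional L \<Longrightarrow>
      I x (\<lambda>u. L (\<phi> u)) = L (\<lambda>y. I x (\<lambda>u. \<phi> u y))"
  shows "shuffle_sum (\<lambda>us. sequence_sum (map I us) \<psi>) xs ys =
    sequence_sum (map I xs) (\<lambda>xs'. sequence_sum (map I ys) (\<lambda>ys'. shuffle_sum \<psi> xs' ys'))"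
proof (induction "length xs + length ys" arbitrary: xs ys \<psi> rule: less_induct)
  case less
  have add_seq: "additive_functional (sequence_sum (map I zs))" for zs
    by (rule additive_sequence_sum) (auto simp: add)
  show ?case
  proof (cases "xs = [] \<or> ys = []")
    case True
    then show ?thesis by auto
  next
    case False
    then obtain x xs' y ys' where eq: "xs = x # xs'" "ys = y # ys'"
      by (meson neq_Nil_conv)
    let ?\<psi> = "\<lambda>u us. \<psi> (u # us)"
    let ?S = "\<lambda>zs. sequence_sum (map I zs)"
    have seq_swap: "?S zs (\<lambda>us. I y (\<theta> us)) = I y (\<lambda>v. ?S zs (\<lambda>us. \<theta> us v))" for zs \<theta>
      by (rule sequence_sum_swap) (rule swap[OF add])
    have "shuffle_sum (\<lambda>us. ?S us \<psi>) xs ys =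
        I x (\<lambda>u. shuffle_sum (\<lambda>us. ?S us (?\<psi> u)) xs' ys) +
        I y (\<lambda>v. shuffle_sum (\<lambda>us. ?S us (?\<psi> v)) xs ys')"
      by (simp add: eq shuffle_sum_swap[OF add])
    also have "\<dots> = I x (\<lambda>u. ?S xs' (\<lambda>us. ?S ys (\<lambda>vs. shuffle_sum (?\<psi> u) us vs))) +
        I y (\<lambda>v. ?S xs (\<lambda>us. ?S ys' (\<lambda>vs. shuffle_sum (?\<psi> v) us vs)))"
      using less by (simp add: eq)
    \<comment> \<open>A shuffle starting with \<open>y\<close> expands \<open>y\<close> first,
      whereas the right-hand side expands all of \<open>xs\<close> before it; \<open>I y\<close> has
      to move inwards.\<close>
    also have "I y (\<lambda>v. ?S xs (\<lambda>us. ?S ys' (\<lambda>vs. shuffle_sum (?\<psi> v) us vs))) =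
        ?S xs (\<lambda>us. I y (\<lambda>v. ?S ys' (\<lambda>vs. shuffle_sum (?\<psi> v) us vs)))"
      by (simp add: seq_swap)
    also have "I x (\<lambda>u. ?S xs' (\<lambda>us. ?S ys (\<lambda>vs. shuffle_sum (?\<psi> u) us vs))) + \<dots> =
        ?S xs (\<lambda>us. ?S ys (\<lambda>vs. shuffle_sum \<psi> us vs))"
      by (simp add: eq additive_functionalD[OF add_seq] additive_functionalD[OF add])
    finally show ?thesis .
  qed
qed

section \<open>Substitution as a sum\<close>

text \<open>The functional \<phi> is abstracted on the right because each branch is visited with a
  different one. A branch without \<open>v\<close> contributes itself as its only term, so taking
  the product over all branches is harmless.\<close>

primrec subst_sum :: "'u \<Rightarrow> 'u prt \<Rightarrow> 'u prt \<Rightarrow> ('u prt \<Rightarrow> 'm::comm_monoid_add) \<Rightarrow> 'm" where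
  "subst_sum v S (B_plus r Ts) =
     (\<lambda>\<phi>. if r = v then shuffle_sum (\<lambda>us. \<phi> (B_plus (root S) us)) Ts (branches S)
          else sequence_sum (map (subst_sum v S) Ts) (\<lambda>us. \<phi> (B_plus r us)))"

lemma additive_subst_sum:
  "additive_functional (subst_sum v S T :: ('u prt \<Rightarrow> 'm::comm_monoid_add) \<Rightarrow> 'm)"
proof (induction T)
  case (B_plus r Ts)
  then have "additive_functional
      (sequence_sum (map (subst_sum v S) Ts) :: ('u prt list \<Rightarrow> 'm) \<Rightarrow> 'm)"
    by (intro additive_sequence_sum) auto
  then show ?case
    by (auto simp: additive_functional_def shuffle_sum_add)
qed

lemma subst_sum_swap:
  assumes "additive_functional L"
  shows "subst_sum v S T (\<lambda>U. L (\<phi> U)) = L (\<lambda>y. subst_sum v S T (\<lambda>U. \<phi> U y))"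
proof (induction T arbitrary: \<phi>)
  case (B_plus r Ts)
  then show ?case
    by (simp add: shuffle_sum_swap[OF assms])
       (auto intro!: sequence_sum_swap)
qed

section \<open>Locating the vertex of substitution\<close>

lemma subst_sum_not_vertex:
  fixes \<phi> :: "'u prt \<Rightarrow> 'm::comm_monoid_add"
  shows "v \<notin> set (vertices T) \<Longrightarrow> subst_sum v S T \<phi> = \<phi> T"
proof (induction T arbitrary: \<phi>)
  case (B_plus r Ts)
  have "sequence_sum (map (subst_sum v S) Us) \<psi> = \<psi> Us" if "set Us \<subseteq> set Ts"
    for Us and \<psi> :: "'u prt list \<Rightarrow> 'm"
    using that B_plus by (induction Us arbitrary: \<psi>) auto
  with B_plus.prems show ?case by auto
qed

lemma sequence_sum_not_vertex:
  "(\<And>T. T \<in> set Ts \<Longrightarrow> v \<notin> set (vertices T)) \<Longrightarrow>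
    sequence_sum (map (subst_sum v S) Ts) \<phi> = \<phi> Ts"
  by (induction Ts arbitrary: \<phi>) (auto simp: subst_sum_not_vertex)

lemma sequence_sum_split:
  assumes "\<And>T. T \<in> set Ts \<union> set Us \<Longrightarrow> v \<notin> set (vertices T)"
  shows "sequence_sum (map (subst_sum v S) (Ts @ T # Us)) \<phi> =
    subst_sum v S T (\<lambda>V. \<phi> (Ts @ V # Us))"
  using assms by (induction Ts arbitrary: \<phi>) (auto simp: subst_sum_not_vertex sequence_sum_not_vertex)

text \<open>Together with \<open>vertex_induct\<close> this carries a statement about the vertex
  \<open>v\<close> at the root down the path to \<open>v\<close>.\<close>

lemma subst_sum_branch:
  assumes "r \<noteq> v" "\<forall>T \<in> set Ts \<union> set Us. v \<notin> set (vertices T)"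
  shows "subst_sum v S (B_plus r (Ts @ T # Us)) \<phi> =
    subst_sum v S T (\<lambda>V. \<phi> (B_plus r (Ts @ V # Us)))"
  using assms(1) sequence_sum_split[OF bspec[OF assms(2)]] by simp

text \<open>Induction along the path from the root to the vertex \<open>v\<close>.\<close>

lemma vertex_induct [consumes 2, case_names vertex branch]:
  assumes "distinct (vertices T)" "v \<in> set (vertices T)"
    and vertex: "\<And>Ts. distinct (vertices (B_plus v Ts)) \<Longrightarrow> P (B_plus v Ts)"
    and branch: "\<And>r Ts T Us. distinct (vertices (B_plus r (Ts @ T # Us))) \<Longrightarrow> r \<noteq> v \<Longrightarrow>
      \<forall>U \<in> set Ts \<union> set Us. v \<notin> set (vertices U) \<Longrightarrow>
      distinct (vertices T) \<Longrightarrow> v \<in> set (vertices T) \<Longrightarrow> P T \<Longrightarrow> P (B_plus r (Ts @ T # Us))"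
  shows "P T"
  using assms(1,2)
proof (induction T)
  case (B_plus r Ts)
  show ?case
  proof (cases "r = v")
    case True
    with B_plus.prems vertex show ?thesis by blast
  next
    case False
    with B_plus.prems obtain T where "T \<in> set Ts" and T: "v \<in> set (vertices T)" by auto
    then obtain Us Vs where Ts: "Ts = Us @ T # Vs" by (meson split_list)
    with B_plus.prems have dist: "distinct (vertices T)" by simp
    have "v \<notin> set (vertices U)" if "U \<in> set Us \<union> set Vs" for U
      using B_plus.prems(1) T that unfolding Ts by auto
    with False T dist B_plus.IH[of T] B_plus.prems(1) show ?thesis
      unfolding Ts by (intro branch) auto
  qed
qed

section \<open>Relabelling and the one-vertex tree\<close>

lemma map_prt_cong_vertices:
  "(\<And>a. a \<in> set (vertices T) \<Longrightarrow> \<sigma> a = \<tau> a) \<Longrightarrow> map_prt \<sigma> T = map_prt \<tau> T"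
  by (induction T) auto

lemma map_prt_eq_self: "(\<And>a. a \<in> set (vertices T) \<Longrightarrow> \<sigma> a = a) \<Longrightarrow> map_prt \<sigma> T = T"
  using map_prt_cong_vertices[of T \<sigma> id] by (simp add: prt.map_id0)

lemma vertices_map_prt [simp]: "vertices (map_prt \<sigma> T) = map \<sigma> (vertices T)"
  by (induction T) (auto simp: map_concat intro!: arg_cong[where f = concat])

text \<open>The one-vertex tree has no branches to shuffle with, so a single term remains, in which
  \<open>w\<close> takes the place of \<open>v\<close>.\<close>

lemma subst_sum_single_vertex_right:
  assumes "distinct (vertices T)" "v \<in> set (vertices T)"
  shows "subst_sum v (B_plus w []) T \<phi> = \<phi> (map_prt (id(v := w)) T)"
  using assms
proof (induction T arbitrary: \<phi> rule: vertex_induct)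
  case (vertex Ts)
  have "map (map_prt (id(v := w))) Ts = Ts"
    by (rule map_idI, rule map_prt_eq_self) (use vertex in auto)
  then have "map_prt (id(v := w)) (B_plus v Ts) = B_plus w Ts"
    by (simp only: prt.map) simp
  then show ?case by (simp only: subst_sum.simps) simp
next
  case (branch r Ts T Us)
  have "map (map_prt (id(v := w))) Ts = Ts" "map (map_prt (id(v := w))) Us = Us"
    by (rule map_idI, rule map_prt_eq_self, use branch in auto)+
  then have "map_prt (id(v := w)) (B_plus r (Ts @ T # Us)) =
      B_plus r (Ts @ map_prt (id(v := w)) T # Us)"
    using branch.hyps(2) by (simp only: prt.map map_append list.map) simp
  with branch show ?case
    by (simp only: subst_sum_branch[OF branch.hyps(2,3)])
qed

text \<open>Injectivity of \<sigma> on \<open>T\<close> keeps \<open>\<sigma> v\<close> away from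
  the other relabelled vertices, so both sides follow the same path. The relabelling of the result
  tests membership in \<open>S\<close> first, since \<open>v\<close> itself may reappear as a label
  of \<open>S\<close>.\<close>

lemma subst_sum_map_prt:
  fixes \<sigma> \<tau> :: "'a \<Rightarrow> 'u" and \<phi> :: "'u prt \<Rightarrow> 'm::comm_monoid_add"
  assumes "distinct (vertices T)" "v \<in> set (vertices T)" "inj_on \<sigma> (set (vertices T))"
    and "(set (vertices T) - {v}) \<inter> set (vertices S) = {}"
  shows "subst_sum (\<sigma> v) (map_prt \<tau> S) (map_prt \<sigma> T) \<phi> =
    subst_sum v S T (\<lambda>U. \<phi> (map_prt (\<lambda>x. if x \<in> set (vertices S) then \<tau> x else \<sigma> x) U))"
    (is "_ = subst_sum v S T (\<lambda>U. \<phi> (map_prt ?\<rho> U))")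
  using assms
proof (induction T arbitrary: \<phi> rule: vertex_induct)
  case (vertex Ts)
  have "map (map_prt \<sigma>) Ts = map (map_prt ?\<rho>) Ts"
    by (rule map_cong[OF refl], rule map_prt_cong_vertices) (use vertex in auto)
  moreover have "map (map_prt \<tau>) (branches S) = map (map_prt ?\<rho>) (branches S)"
    by (rule map_cong[OF refl], rule map_prt_cong_vertices) (cases S, auto)
  moreover have "root S \<in> set (vertices S)" by (cases S) auto
  ultimately show ?case
    by (cases S) (simp add: shuffle_sum_map del: map_eq_conv)
next
  case (branch r Ts T Us)
  let ?X = "set (vertices (B_plus r (Ts @ T # Us)))"
  have sub: "a \<in> ?X - {v}" if "U \<in> set Ts \<union> set Us" "a \<in> set (vertices U)" for a U
    using branch.hyps(3) that by auto
  have ne: "\<sigma> v \<noteq> \<sigma> a" "a \<notin> set (vertices S)" if "a \<in> ?X - {v}" for a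
  proof -
    have "v \<in> ?X" using branch.hyps(5) by auto
    with that show "\<sigma> v \<noteq> \<sigma> a" using branch.prems(1) by (auto simp only: dest: inj_onD)
    show "a \<notin> set (vertices S)" using that branch.prems(2) by blast
  qed
  have eq: "map_prt \<sigma> U = map_prt ?\<rho> U" if "U \<in> set Ts \<union> set Us" for U
    by (rule map_prt_cong_vertices) (simp add: ne(2)[OF sub[OF that]])
  have map_eq: "map (map_prt \<sigma>) Ts = map (map_prt ?\<rho>) Ts"
      "map (map_prt \<sigma>) Us = map (map_prt ?\<rho>) Us"
    using eq by simp_all
  have r: "\<sigma> r \<noteq> \<sigma> v" "r \<notin> set (vertices S)"
    using ne[of r] branch.hyps(2) by auto
  have notin: "\<forall>U \<in> set (map (map_prt \<sigma>) Ts) \<union> set (map (map_prt \<sigma>) Us).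
      \<sigma> v \<notin> set (vertices U)"
  proof -
    have "\<sigma> v \<notin> \<sigma> ` set (vertices U)" if "U \<in> set Ts \<union> set Us" for U
      using ne(1)[OF sub[OF that]] by auto
    then show ?thesis by auto
  qed
  have "inj_on \<sigma> (set (vertices T))"
    using branch.prems(1) by (rule inj_on_subset) auto
  then have IH: "subst_sum (\<sigma> v) (map_prt \<tau> S) (map_prt \<sigma> T) \<psi> =
      subst_sum v S T (\<lambda>U. \<psi> (map_prt ?\<rho> U))" for \<psi> :: "'u prt \<Rightarrow> 'm"
    by (rule branch.IH) (use branch.prems(2) in auto)
  have "subst_sum (\<sigma> v) (map_prt \<tau> S) (map_prt \<sigma> (B_plus r (Ts @ T # Us))) \<phi> =
      subst_sum v S T (\<lambda>U. \<phi> (B_plus (\<sigma> r)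
        (map (map_prt \<sigma>) Ts @ map_prt ?\<rho> U # map (map_prt \<sigma>) Us)))"
    by (simp only: prt.map map_append list.map subst_sum_branch[OF r(1) notin] IH)
  then show ?case
    unfolding subst_sum_branch[OF branch.hyps(2,3)] map_eq by (simp add: r)
qed

section \<open>Labels of the trees obtained by substitution\<close>

lemma shuffle_sum_closed:
  assumes "\<And>x y. x \<in> V \<Longrightarrow> y \<in> V \<Longrightarrow> x + y \<in> V"
    and "\<And>zs. mset zs = mset xs + mset ys \<Longrightarrow> \<phi> zs \<in> V"
  shows "shuffle_sum \<phi> xs ys \<in> V"
  using assms(2)
  by (induction \<phi> xs ys rule: shuffle_sum.induct) (auto intro!: assms(1))

lemma mset_concat_vertices:
  "mset (concat (map vertices Ts)) = (\<Sum>T\<in>#mset Ts. mset (vertices T))"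
  by (induction Ts) auto

text \<open>Shuffling preserves the multiset of branches, hence that of labels. Adding
  \<open>v\<close> on the left avoids truncated subtraction and stays correct when \<open>v\<close>
  is also a label of \<open>S\<close>.\<close>

lemma subst_sum_closed:
  assumes "distinct (vertices T)" "v \<in> set (vertices T)"
    and add: "\<And>x y. x \<in> V \<Longrightarrow> y \<in> V \<Longrightarrow> x + y \<in> V"
    and "\<And>U. mset (vertices U) + {#v#} = mset (vertices T) + mset (vertices S) \<Longrightarrow> \<phi> U \<in> V"
  shows "subst_sum v S T \<phi> \<in> V"
  using assms(1,2,4)
proof (induction T arbitrary: \<phi> rule: vertex_induct)
  case (vertex Ts)
  then show ?case
    by (cases S) (auto simp: mset_concat_vertices intro!: shuffle_sum_closed[OF add])
next
  case (branch r Ts T Us)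
  show ?case
    unfolding subst_sum_branch[OF branch.hyps(2,3)]
    by (rule branch.IH, rule branch.prems) (simp add: ac_simps)
qed

text \<open>Distinctness and the set of labels become one multiset equation, the form in which
  substitution controls labels.\<close>

lemma labelled_by_iff_mset:
  "labelled_by T A \<longleftrightarrow> finite A \<and> mset (vertices T) = mset_set A"
proof
  assume "labelled_by T A"
  then show "finite A \<and> mset (vertices T) = mset_set A"
    by (auto simp: labelled_by_def mset_set_set)
next
  assume A: "finite A \<and> mset (vertices T) = mset_set A"
  then have "set (vertices T) = A"
    by (metis finite_set_mset_mset_set set_mset_mset)
  moreover from this A have "distinct (vertices T)"
    by (simp add: distinct_count_atmost_1 count_mset_set')
  ultimately show "labelled_by T A" by (simp add: labelled_by_def)
qed

lemma labelled_by_glue: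
  assumes "composable A v B" "labelled_by T A" "labelled_by S B"
    and "mset (vertices U) + {#v#} = mset (vertices T) + mset (vertices S)"
  shows "labelled_by U (glue A v B)"
proof -
  have fin: "finite A" "finite B" "v \<in> A" "(A - {v}) \<inter> B = {}"
    using assms(1) by (auto simp: composable_def)
  have "mset (vertices U) + {#v#} = mset_set A + mset_set B"
    using assms by (simp add: labelled_by_iff_mset)
  also have "mset_set A = mset_set (A - {v}) + {#v#}"
    using fin mset_set.remove[of A v] by simp
  finally have "mset (vertices U) = mset_set (A - {v}) + mset_set B"
    by (simp add: ac_simps)
  also have "\<dots> = mset_set (glue A v B)"
    unfolding glue_def using fin by (simp add: mset_set_Union)
  finally show ?thesis
    using fin by (simp add: labelled_by_iff_mset glue_def)
qed

text \<open>Down to \<open>v\<close> both sides follow the same path. At \<open>v\<close>, either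
  \<open>w\<close> is the root of \<open>S\<close> and three lists of branches are shuffled, or
  \<open>w\<close> lies in a branch of \<open>S\<close> and substitution there commutes with
  shuffling. The case \<open>w = v\<close> is included.\<close>

lemma subst_sum_nested:
  assumes "distinct (vertices T)" "v \<in> set (vertices T)"
    and "distinct (vertices S)" "w \<in> set (vertices S)"
    and "w \<notin> set (vertices T) - {v}"
  shows "subst_sum v S T (\<lambda>U. subst_sum w R U \<phi>) = subst_sum w R S (\<lambda>X. subst_sum v X T \<phi>)"
  using assms(1,2,5)
proof (induction T arbitrary: \<phi> rule: vertex_induct)
  case (vertex Ts)
  have notin: "w \<notin> set (vertices T)" if "T \<in> set Ts" for T
    using vertex that by auto
  obtain s Ss where S: "S = B_plus s Ss" by (cases S)
  show ?case
  proof (cases "w = s")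
    case True
    then show ?thesis by (simp add: S shuffle_sum_assoc)
  next
    case False
    \<comment> \<open>The branches of \<open>T\<close> do not contain \<open>w\<close>, so their
      expansion is trivial and only the branches of \<open>S\<close> are affected.\<close>
    then show ?thesis
      by (simp add: S shuffle_sum_sequence_sum[OF additive_subst_sum subst_sum_swap]
          sequence_sum_not_vertex notin)
  qed
next
  case (branch r Ts T Us)
  have "w \<noteq> r" "w \<notin> set (vertices T) - {v}"
    and notin: "\<forall>U \<in> set Ts \<union> set Us. w \<notin> set (vertices U)"
    using branch by auto
  show ?case
    by (simp only: branch.IH[OF \<open>w \<notin> set (vertices T) - {v}\<close>] subst_sum_branch[OF branch.hyps(2,3)]
        subst_sum_branch[OF \<open>w \<noteq> r\<close>[symmetric] notin])
qed

text \<open>If one of the two vertices is the root, the other is sought in the branches, and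
  substitution there commutes with shuffling in branches that do not contain it. Otherwise the two
  substitutions act branchwise and commute by induction.\<close>

lemma subst_sum_disjoint:
  fixes \<phi> :: "'u prt \<Rightarrow> 'm::comm_monoid_add"
  assumes "v \<noteq> w" "w \<notin> set (vertices S)" "v \<notin> set (vertices R)"
  shows "subst_sum v S T (\<lambda>U. subst_sum w R U \<phi>) = subst_sum w R T (\<lambda>U. subst_sum v S U \<phi>)"
proof (induction T arbitrary: \<phi>)
  case (B_plus r Ts)
  have notin: "w \<notin> set (vertices U)" if "U \<in> set (branches S)" for U
    using assms that by (cases S) auto
  have notin': "v \<notin> set (vertices U)" if "U \<in> set (branches R)" for U
    using assms that by (cases R) auto
  have root: "w \<noteq> root S" "v \<noteq> root R"
    using assms by (cases S; cases R; auto)+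
  consider "r = v" | "r = w" | "r \<noteq> v" "r \<noteq> w" by blast
  then show ?case
  proof cases
    case 3
    have "sequence_sum (map (subst_sum v S) Us) (\<lambda>Us. sequence_sum (map (subst_sum w R) Us) \<psi>) =
        sequence_sum (map (subst_sum w R) Us) (\<lambda>Us. sequence_sum (map (subst_sum v S) Us) \<psi>)"
      if "set Us \<subseteq> set Ts" for Us and \<psi> :: "'u prt list \<Rightarrow> 'm"
      using that
    proof (induction Us arbitrary: \<psi>)
      case (Cons U Us)
      have IH: "subst_sum v S U (\<lambda>U. subst_sum w R U \<chi>) = subst_sum w R U (\<lambda>U. subst_sum v S U \<chi>)"
        for \<chi> :: "'u prt \<Rightarrow> 'm"
        using B_plus Cons.prems by auto
      let ?s = "sequence_sum (map (subst_sum v S) Us)" and ?r = "sequence_sum (map (subst_sum w R) Us)"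
      \<comment> \<open>\<open>s\<close> and \<open>r\<close> move a sum over one branch past the
        sums over the remaining branches. This brings the two substitutions in \<open>U\<close> next
        to each other, where \<open>IH\<close> applies.\<close>
      have s: "?s (\<lambda>Us. subst_sum x Q Y (\<chi> Us)) = subst_sum x Q Y (\<lambda>V. ?s (\<lambda>Us. \<chi> Us V))"
        for x Q Y and \<chi> :: "'u prt list \<Rightarrow> 'u prt \<Rightarrow> 'm"
        by (rule sequence_sum_swap) (rule subst_sum_swap[OF additive_subst_sum])
      have r: "?r (\<lambda>Us. subst_sum x Q Y (\<chi> Us)) = subst_sum x Q Y (\<lambda>V. ?r (\<lambda>Us. \<chi> Us V))"
        for x Q Y and \<chi> :: "'u prt list \<Rightarrow> 'u prt \<Rightarrow> 'm"
        by (rule sequence_sum_swap) (rule subst_sum_swap[OF additive_subst_sum])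
      show ?case using Cons by (simp add: s r IH)
    qed simp
    with 3 show ?thesis by simp
  qed (use assms root in \<open>simp_all add: shuffle_sum_sequence_sum[OF additive_subst_sum subst_sum_swap]
      sequence_sum_not_vertex notin notin'\<close>)
qed

section \<open>Increasing maps and shuffles\<close>

text \<open>The list of branches that \<open>graft\<close> builds at a root, in recursive form:
  block \<open>g i\<close> fills gap \<open>i\<close>. The offset \<open>j\<close> lets the
  numbering of the gaps continue on tails.\<close>

fun weave :: "(nat \<Rightarrow> 'a list) \<Rightarrow> nat \<Rightarrow> 'a list \<Rightarrow> 'a list" where
  "weave g j [] = g j"
| "weave g j (x # xs) = g j @ x # weave g (Suc j) xs"

lemma concat_map2_eq_weave:
  "concat (map2 (\<lambda>i x. g i @ [x]) [j..<j + length xs] xs) @ g (j + length xs) = weave g j xs"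
proof (induction xs arbitrary: j)
  case (Cons x xs)
  from Cons.IH[of "Suc j"] show ?case by (simp add: upt_conv_Cons del: upt_Suc)
qed simp

lemma weave_cong: "(\<And>i. i \<ge> j \<Longrightarrow> g i = h i) \<Longrightarrow> weave g j xs = weave h j xs"
  by (induction xs arbitrary: j) auto

lemma weave_Nil: "weave (\<lambda>i. []) j xs = xs"
  by (induction xs arbitrary: j) auto

lemma graft_eq_weave:
  "graft g (B_plus r Ss) = B_plus r (weave (\<lambda>i. g (r, i)) 0 (map (graft g) Ss))"
  using concat_map2_eq_weave[of "\<lambda>i. g (r, i)" 0 "map (graft g) Ss"] by simp

lemma graft_eq_self:
  "(\<And>a i. a \<in> set (vertices S) \<Longrightarrow> g (a, i) = []) \<Longrightarrow> graft g S = S"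
proof (induction S)
  case (B_plus r Ss)
  then have "map (graft g) Ss = Ss"
    by (intro map_idI) auto
  with B_plus.prems show ?case
    by (simp add: graft_eq_weave weave_Nil del: graft.simps)
qed

text \<open>
  The increasing map that sends the \<open>i\<close>-th edge to the angle \<open>(root S, m\<^sub>i)\<close> is encoded by the sorted
  list of the \<open>m\<^sub>i\<close>. The offset \<open>j\<close> makes the recursion over the branches of \<open>S\<close> possible.
\<close>

definition sorted_lists :: "nat \<Rightarrow> nat \<Rightarrow> nat \<Rightarrow> nat list set" where
  "sorted_lists n j k = {ms. length ms = n \<and> sorted ms \<and> set ms \<subseteq> {j..j + k}}"

lemma finite_sorted_lists: "finite (sorted_lists n j k)"
  by (rule finite_subset[OF _ finite_lists_length_eq[of "{j..j + k}" n]])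
     (auto simp: sorted_lists_def)

lemma sorted_lists_0_left: "sorted_lists 0 j k = {[]}"
  by (auto simp: sorted_lists_def)

lemma sorted_lists_0_right: "sorted_lists n j 0 = {replicate n j}"
  by (auto simp: sorted_lists_def intro!: replicate_eqI)

text \<open>A sorted list either starts with the least value \<open>j\<close> or avoids it. For
  increasing maps: the first edge goes into the leftmost angle, or that angle stays empty.\<close>

lemma sorted_lists_Suc:
  "sorted_lists (Suc n) j (Suc k) =
    (#) j ` sorted_lists n j (Suc k) \<union> sorted_lists (Suc n) (Suc j) k"
proof (intro equalityI subsetI)
  fix ms assume ms: "ms \<in> sorted_lists (Suc n) j (Suc k)"
  then obtain m ms' where eq: "ms = m # ms'" by (auto simp: sorted_lists_def length_Suc_conv)
  from ms eq have "x \<ge> m" "x \<ge> j" "x \<le> Suc (j + k)" if "x \<in> set ms" for x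
    using that by (auto simp: sorted_lists_def)
  with ms eq show "ms \<in> (#) j ` sorted_lists n j (Suc k) \<union> sorted_lists (Suc n) (Suc j) k"
    by (cases "m = j") (fastforce simp: sorted_lists_def)+
qed (auto simp: sorted_lists_def subset_iff Suc_le_eq)

definition attached :: "(nat \<times> 'a) list \<Rightarrow> nat \<Rightarrow> 'a list" where
  "attached ps i = map snd (filter (\<lambda>p. fst p = i) ps)"

lemma attached_replicate: "attached (zip (replicate (length xs) j) xs) j = xs"
  by (induction xs) (auto simp: attached_def)

text \<open>The split in \<open>sorted_lists_Suc\<close> matches the recursion for shuffles: a
  sorted list starting with \<open>j\<close> puts \<open>x\<close> first, any other puts
  \<open>y\<close> first and raises the offset.\<close>

lemma sum_weave_eq_shuffle_sum:
  "(\<Sum>ms \<in> sorted_lists (length xs) j (length ys). \<phi> (weave (attached (zip ms xs)) j ys)) =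
    shuffle_sum \<phi> xs ys"
proof (induction \<phi> xs ys arbitrary: j rule: shuffle_sum.induct)
  case (1 \<phi> ys)
  then show ?case by (simp add: sorted_lists_0_left attached_def weave_Nil)
next
  case (2 \<phi> x xs)
  show ?case using attached_replicate[of "x # xs" j] by (simp add: sorted_lists_0_right)
next
  case (3 \<phi> x xs y ys)
  let ?A = "sorted_lists (length xs) j (length (y # ys))"
  let ?B = "sorted_lists (length (x # xs)) (Suc j) (length ys)"
  let ?w = "\<lambda>ms. \<phi> (weave (attached (zip ms (x # xs))) j (y # ys))"
  have "(\<Sum>ms \<in> sorted_lists (length (x # xs)) j (length (y # ys)). ?w ms) =
      (\<Sum>ms \<in> (#) j ` ?A \<union> ?B. ?w ms)"
    by (simp add: sorted_lists_Suc)
  also have "\<dots> = (\<Sum>ms \<in> (#) j ` ?A. ?w ms) + (\<Sum>ms \<in> ?B. ?w ms)"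
    by (intro sum.union_disjoint finite_imageI finite_sorted_lists) (auto simp: sorted_lists_def)
  also have "(\<Sum>ms \<in> (#) j ` ?A. ?w ms) = (\<Sum>ms \<in> ?A. ?w (j # ms))"
    by (subst sum.reindex) auto
  also have "\<dots> = (\<Sum>ms \<in> ?A. \<phi> (x # weave (attached (zip ms xs)) j (y # ys)))"
  proof (rule sum.cong[OF refl])
    fix ms
    \<comment> \<open>The entry numbered \<open>j\<close> is invisible to the gaps from
      \<open>Suc j\<close> onwards.\<close>
    have "weave (attached ((j, x) # zip ms xs)) (Suc j) ys = weave (attached (zip ms xs)) (Suc j) ys"
      by (rule weave_cong) (simp add: attached_def)
    then show "?w (j # ms) = \<phi> (x # weave (attached (zip ms xs)) j (y # ys))"
      by (simp add: attached_def)
  qed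
  also have "(\<Sum>ms \<in> ?B. ?w ms) = (\<Sum>ms \<in> ?B. \<phi> (y # weave (attached (zip ms (x # xs))) (Suc j) ys))"
  proof (rule sum.cong[OF refl])
    fix ms assume "ms \<in> ?B"
    then have "attached (zip ms (x # xs)) j = []"
      by (auto simp: attached_def sorted_lists_def filter_empty_conv dest: set_zip_leftD)
    then show "?w ms = \<phi> (y # weave (attached (zip ms (x # xs))) (Suc j) ys)"
      by simp
  qed
  finally show ?case using 3 by simp
qed

section \<open>The order of the angles at the root\<close>

definition precedes :: "'a list \<Rightarrow> 'a \<Rightarrow> 'a \<Rightarrow> bool" where
  "precedes xs x y \<longleftrightarrow> (\<exists>i j. i \<le> j \<and> j < length xs \<and> xs ! i = x \<and> xs ! j = y)"

lemma precedes_Nil [simp]: "\<not> precedes [] x y"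
  by (simp add: precedes_def)

lemma precedes_Cons [simp]:
  "precedes (z # zs) x y \<longleftrightarrow> z = x \<and> y \<in> set (z # zs) \<or> precedes zs x y"
proof
  assume "precedes (z # zs) x y"
  then obtain i j where "i \<le> j" "j < length (z # zs)" "(z # zs) ! i = x" "(z # zs) ! j = y"
    unfolding precedes_def by blast
  then show "z = x \<and> y \<in> set (z # zs) \<or> precedes zs x y"
    unfolding precedes_def by (cases i; cases j) (auto simp: less_Suc_eq_0_disj)
next
  assume "z = x \<and> y \<in> set (z # zs) \<or> precedes zs x y"
  then show "precedes (z # zs) x y"
  proof (elim disjE conjE)
    assume "z = x" "y \<in> set (z # zs)"
    then obtain j where "j < length (z # zs)" "(z # zs) ! j = y"
      by (metis in_set_conv_nth)
    with \<open>z = x\<close> show ?thesis unfolding precedes_def by (intro exI[of _ 0] exI[of _ j]) auto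
  next
    assume "precedes zs x y"
    then obtain i j where "i \<le> j" "j < length zs" "zs ! i = x" "zs ! j = y"
      unfolding precedes_def by blast
    then show ?thesis unfolding precedes_def by (intro exI[of _ "Suc i"] exI[of _ "Suc j"]) auto
  qed
qed

text \<open>The order induced on the root angles can thus be read off the sublist of these
  angles.\<close>

lemma precedes_filter: "P x \<Longrightarrow> P y \<Longrightarrow> precedes (filter P zs) x y \<longleftrightarrow> precedes zs x y"
  by (induction zs) auto

lemma fst_angles: "x \<in> set (angles S) \<Longrightarrow> fst x \<in> set (vertices S)"
proof (induction S)
  case (B_plus r Ss)
  then show ?case
    by (auto dest!: set_zip_rightD) (metis fst_conv)
qed

text \<open>Distinct labels ensure that no angle inside a branch carries the root label, so only the
  separators between the branches and the final angle survive.\<close>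

lemma filter_root_angles:
  assumes "distinct (vertices (B_plus s Ss))"
  shows "filter (\<lambda>x. fst x = s) (angles (B_plus s Ss)) = map (Pair s) [0..<Suc (length Ss)]"
proof -
  have "filter (\<lambda>x. fst x = s)
      (concat (map2 (\<lambda>i as. (s, i) # as) [j..<j + length Us] (map angles Us))) =
      map (Pair s) [j..<j + length Us]" if "set Us \<subseteq> set Ss" for j Us
    using that
  proof (induction Us arbitrary: j)
    case (Cons U Us)
    have "filter (\<lambda>x. fst x = s) (angles U) = []"
      using assms Cons.prems fst_angles[of _ U] by (auto simp: filter_empty_conv)
    with Cons.IH[of "Suc j"] Cons.prems show ?case by (simp add: upt_conv_Cons del: upt_Suc)
  qed simp
  from this[of Ss 0] show ?thesis by simp
qed

lemma Ang0_eq: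
  assumes "distinct (vertices (B_plus s Ss))"
  shows "Ang0 (B_plus s Ss) = Pair s ` {..length Ss}"
proof -
  have "Ang0 (B_plus s Ss) = set (filter (\<lambda>x. fst x = s) (angles (B_plus s Ss)))"
    unfolding Ang0_def Ang_def by auto
  also have "\<dots> = Pair s ` {..length Ss}"
    unfolding filter_root_angles[OF assms] by (auto simp: less_Suc_eq_le simp del: upt_Suc)
  finally show ?thesis .
qed

lemma angle_le_root_iff:
  assumes "distinct (vertices (B_plus s Ss))" "i \<le> length Ss" "j \<le> length Ss"
  shows "angle_le (B_plus s Ss) (s, i) (s, j) \<longleftrightarrow> i \<le> j"
proof -
  have "angle_le (B_plus s Ss) (s, i) (s, j) \<longleftrightarrow>
      precedes (map (Pair s) [0..<Suc (length Ss)]) (s, i) (s, j)"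
    unfolding filter_root_angles[OF assms(1), symmetric]
    by (subst precedes_filter) (auto simp: precedes_def angle_le_def)
  also have "\<dots> \<longleftrightarrow> i \<le> j"
  proof -
    have nth: "map (Pair s) [0..<Suc (length Ss)] ! m = (s, m)" if "m \<le> length Ss" for m
      using that by (simp add: less_Suc_eq_le del: upt_Suc)
    show ?thesis
    proof
      assume "precedes (map (Pair s) [0..<Suc (length Ss)]) (s, i) (s, j)"
      then show "i \<le> j"
        by (auto simp: precedes_def less_Suc_eq_le nth simp del: upt_Suc)
    next
      assume "i \<le> j"
      then show "precedes (map (Pair s) [0..<Suc (length Ss)]) (s, i) (s, j)"
        unfolding precedes_def using assms(2,3)
        by - (rule exI[of _ i], rule exI[of _ j], simp add: nth less_Suc_eq_le del: upt_Suc)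
    qed
  qed
  finally show ?thesis .
qed

lemma incr_maps_Ang0_eq:
  assumes "distinct (vertices (B_plus s Ss))"
  shows "incr_maps T v (B_plus s Ss) (Ang0 (B_plus s Ss)) =
    {f \<in> {..<num_children T v} \<rightarrow>\<^sub>E Pair s ` {..length Ss}.
      \<forall>i < num_children T v. \<forall>j < num_children T v. i \<le> j \<longrightarrow> snd (f i) \<le> snd (f j)}"
proof -
  have "angle_le (B_plus s Ss) (f i) (f j) \<longleftrightarrow> snd (f i) \<le> snd (f j)"
    if f: "f \<in> {..<num_children T v} \<rightarrow>\<^sub>E Pair s ` {..length Ss}"
      and ij: "i < num_children T v" "j < num_children T v" for f i j
  proof -
    obtain a b where "f i = (s, a)" "f j = (s, b)" "a \<le> length Ss" "b \<le> length Ss"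
      using PiE_mem[OF f, of i] PiE_mem[OF f, of j] ij by auto
    then show ?thesis by (simp add: angle_le_root_iff[OF assms])
  qed
  then show ?thesis
    unfolding incr_maps_def in_edges_def Ang0_eq[OF assms]
    by (auto simp: monotone_on_def)
qed

section \<open>From increasing maps to shuffles\<close>

lemma num_children_not_vertex: "v \<notin> set (vertices T) \<Longrightarrow> num_children T v = 0"
  by (induction T) auto

lemma subst_tree_not_vertex: "v \<notin> set (vertices T) \<Longrightarrow> subst_tree v f S T = T"
  by (induction T) (auto intro!: map_idI)

text \<open>This links the defining sum over increasing maps with the recursive one. At
  \<open>v\<close>, an increasing map is recorded by the sorted list of its angle indices; above the
  root, only the branch containing \<open>v\<close> matters.\<close>

lemma sum_incr_maps_eq_subst_sum:
  fixes \<phi> :: "'u prt \<Rightarrow> 'm::comm_monoid_add"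
  assumes "distinct (vertices T)" "v \<in> set (vertices T)" "distinct (vertices S)"
  shows "(\<Sum>f \<in> incr_maps T v S (Ang0 S). \<phi> (subst_tree v f S T)) = subst_sum v S T \<phi>"
  using assms(1,2)
proof (induction T arbitrary: \<phi> rule: vertex_induct)
  case (vertex Ts)
  obtain s Ss where S: "S = B_plus s Ss" by (cases S)
  note dist = assms(3)[unfolded S]
  let ?n = "length Ts"
  \<comment> \<open>Mutually inverse translations. The restriction gives \<open>undefined\<close>
    beyond the edges, as the extensional function space demands.\<close>
  let ?i = "\<lambda>ms. \<lambda>i \<in> {..<?n}. (s, ms ! i)" and ?j = "\<lambda>f. map (snd \<circ> f) [0..<?n]"
  let ?F = "{f \<in> {..<?n} \<rightarrow>\<^sub>E Pair s ` {..length Ss}.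
      \<forall>i < ?n. \<forall>j < ?n. i \<le> j \<longrightarrow> snd (f i) \<le> snd (f j)}"
  have fst_f: "fst (f i) = s" "snd (f i) \<le> length Ss" if "f \<in> ?F" "i < ?n" for f i
  proof -
    have "f i \<in> Pair s ` {..length Ss}"
      using that by (blast dest: PiE_mem)
    then show "fst (f i) = s" "snd (f i) \<le> length Ss" by auto
  qed
  have "(\<Sum>f \<in> ?F. \<phi> (subst_tree v f S (B_plus v Ts))) =
      (\<Sum>ms \<in> sorted_lists ?n 0 (length Ss).
        \<phi> (B_plus s (weave (attached (zip ms Ts)) 0 Ss)))"
  proof (rule sum.reindex_bij_witness[of _ ?i ?j])
    fix f assume f: "f \<in> ?F"
    show "?i (?j f) = f"
    proof
      fix i
      show "?i (?j f) i = f i"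
        using f fst_f[OF f, of i] by (cases "i < ?n") (auto simp: PiE_iff extensional_def prod_eq_iff)
    qed
    show "?j f \<in> sorted_lists ?n 0 (length Ss)"
      using f fst_f[OF f] by (auto simp: sorted_lists_def sorted_iff_nth_mono)
    let ?g = "\<lambda>x. map (\<lambda>i. Ts ! i) (filter (\<lambda>i. f i = x) [0..<?n])"
    \<comment> \<open>All values of \<open>f\<close> are root angles, so grafting leaves the
      branches of \<open>S\<close> intact.\<close>
    have g: "?g (a, k) = []" if "a \<noteq> s" for a k
      using that fst_f[OF f] by (force simp: filter_empty_conv)
    have "map (graft ?g) Ss = Ss"
      by (intro map_idI graft_eq_self g) (use dist in auto)
    moreover have "?g (s, k) = attached (zip (?j f) Ts) k" for k
    proof -
      have "zip (?j f) Ts = map (\<lambda>i. (snd (f i), Ts ! i)) [0..<?n]"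
        by (rule nth_equalityI) auto
      moreover have "f i = (s, k) \<longleftrightarrow> snd (f i) = k" if "i < ?n" for i
        using fst_f[OF f that] by (auto simp: prod_eq_iff)
      then have "filter (\<lambda>i. f i = (s, k)) [0..<?n] = filter (\<lambda>i. snd (f i) = k) [0..<?n]"
        by (intro filter_cong) auto
      ultimately show ?thesis
        by (simp add: attached_def filter_map comp_def)
    qed
    ultimately show "\<phi> (B_plus s (weave (attached (zip (?j f) Ts)) 0 Ss)) =
        \<phi> (subst_tree v f S (B_plus v Ts))"
      by (simp add: S graft_eq_weave del: graft.simps)
  next
    fix ms assume ms: "ms \<in> sorted_lists ?n 0 (length Ss)"
    then show "?j (?i ms) = ms"
      by (auto simp: sorted_lists_def intro!: nth_equalityI)
    have "ms ! i \<le> length Ss" if "i < ?n" for i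
      using ms that nth_mem[of i ms] by (auto simp: sorted_lists_def simp del: nth_mem)
    then show "?i ms \<in> ?F"
      using ms by (auto simp: sorted_lists_def sorted_iff_nth_mono)
  qed
  also have "\<dots> = shuffle_sum (\<lambda>us. \<phi> (B_plus s us)) Ts Ss"
    by (rule sum_weave_eq_shuffle_sum)
  finally show ?case by (simp add: S incr_maps_Ang0_eq[OF dist])
next
  case (branch r Ts T Us)
  have zero: "sum_list (map (\<lambda>T. num_children T v) Xs) = 0"
    and self: "map (subst_tree v f S) Xs = Xs"
    if "\<forall>X \<in> set Xs. v \<notin> set (vertices X)" for Xs f
    using that by (auto simp: num_children_not_vertex subst_tree_not_vertex intro!: map_idI)
  have "num_children (B_plus r (Ts @ T # Us)) v = num_children T v"
    using branch.hyps(2,3) by (simp add: zero)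
  then have "incr_maps (B_plus r (Ts @ T # Us)) v S (Ang0 S) = incr_maps T v S (Ang0 S)"
    by (simp add: incr_maps_def in_edges_def)
  moreover have "subst_tree v f S (B_plus r (Ts @ T # Us)) =
      B_plus r (Ts @ subst_tree v f S T # Us)" for f
    using branch.hyps(2,3) by (simp add: self)
  ultimately show ?case
    unfolding subst_sum_branch[OF branch.hyps(2,3)]
    by (simp only: branch.IH[of "\<lambda>U. \<phi> (B_plus r (Ts @ U # Us))"])
qed

section \<open>Linear extension\<close>

lemma lookup_pscale: "Poly_Mapping.lookup (pscale c x) t = c * Poly_Mapping.lookup x t"
  unfolding pscale_def by (simp add: Poly_Mapping.map.rep_eq when_def)

interpretation pscale: vector_space "pscale :: 'k::field \<Rightarrow> ('t \<Rightarrow>\<^sub>0 'k) \<Rightarrow> ('t \<Rightarrow>\<^sub>0 'k)"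
  by standard (auto intro!: poly_mapping_eqI simp: lookup_pscale lookup_add algebra_simps)

text \<open>Linear extension of a map given on a basis: the bind of the free vector space, with
  \<open>basis\<close> as its unit.\<close>

definition lin :: "('a \<Rightarrow> ('b \<Rightarrow>\<^sub>0 'k::field)) \<Rightarrow> ('a \<Rightarrow>\<^sub>0 'k) \<Rightarrow> ('b \<Rightarrow>\<^sub>0 'k)" where
  "lin F x = (\<Sum>t \<in> Poly_Mapping.keys x. pscale (Poly_Mapping.lookup x t) (F t))"

text \<open>Supports may shrink by cancellation; a common finite superset makes sums over different
  supports comparable.\<close>

lemma lin_superset:
  assumes "finite K" "Poly_Mapping.keys x \<subseteq> K"
  shows "lin F x = (\<Sum>t \<in> K. pscale (Poly_Mapping.lookup x t) (F t))"
  unfolding lin_def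
  by (rule sum.mono_neutral_left) (use assms in \<open>auto simp: in_keys_iff\<close>)

lemma lin_add: "lin F (x + y) = lin F x + lin F y"
proof -
  let ?K = "Poly_Mapping.keys x \<union> Poly_Mapping.keys y"
  have "Poly_Mapping.keys (x + y) \<subseteq> ?K" by (rule keys_add)
  then show ?thesis
    by (simp add: lin_superset[of ?K] lookup_add pscale.scale_left_distrib sum.distrib)
qed

lemma keys_pscale: "Poly_Mapping.keys (pscale c x) \<subseteq> Poly_Mapping.keys x"
  by (auto simp: in_keys_iff lookup_pscale)

lemma lin_pscale: "lin F (pscale c x) = pscale c (lin F x)"
  using lin_superset[OF finite_keys keys_pscale, of F c x]
  by (simp add: lin_def[of F x] lookup_pscale pscale.scale_sum_right)

lemma lin_0 [simp]: "lin F 0 = 0"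
  by (simp add: lin_def)

lemma lin_sum: "lin F (\<Sum>i \<in> I. x i) = (\<Sum>i \<in> I. lin F (x i))"
  by (induction I rule: infinite_finite_induct) (auto simp: lin_add)

lemma lin_single [simp]: "lin F (Poly_Mapping.single t c) = pscale c (F t)"
  using lin_superset[of "{t}" "Poly_Mapping.single t c" F] by simp

lemma lin_lin: "lin F (lin G x) = lin (\<lambda>t. lin F (G t)) x"
  by (simp add: lin_def[of G] lin_def[of "\<lambda>t. lin F (G t)"] lin_sum lin_pscale)

lemma lin_swap: "lin (\<lambda>t. lin (\<lambda>s. F t s) y) x = lin (\<lambda>s. lin (\<lambda>t. F t s) x) y"
  unfolding lin_def
  by (simp add: pscale.scale_sum_right)
     (subst sum.swap, simp only: mult.commute)

lemma lin_cong:
  "(\<And>t. t \<in> Poly_Mapping.keys x \<Longrightarrow> F t = G t) \<Longrightarrow> lin F x = lin G x"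
  by (simp add: lin_def)

lemma lin_add_fun: "lin (\<lambda>t. F t + G t) x = lin F x + lin G x"
  by (simp add: lin_def pscale.scale_right_distrib sum.distrib)

lemma lin_pscale_fun: "lin (\<lambda>t. pscale c (F t)) x = pscale c (lin F x)"
  by (simp add: lin_def pscale.scale_sum_right mult.commute)

lemma pscale_single [simp]: "pscale c (Poly_Mapping.single t d) = Poly_Mapping.single t (c * d)"
  by (rule poly_mapping_eqI) (simp add: lookup_pscale lookup_single when_def)

abbreviation basis :: "'a \<Rightarrow> ('a \<Rightarrow>\<^sub>0 'k::field)" where
  "basis t \<equiv> Poly_Mapping.single t 1"

lemma lin_basis: "lin basis x = x"
proof (rule poly_mapping_eqI)
  fix t
  have "Poly_Mapping.lookup (lin basis x) t =
      (\<Sum>s \<in> Poly_Mapping.keys x. if s = t then Poly_Mapping.lookup x s else 0)"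
    by (simp add: lin_def lookup_sum lookup_single when_def)
  then show "Poly_Mapping.lookup (lin basis x) t = Poly_Mapping.lookup x t"
    by (simp add: in_keys_iff)
qed

lemma lin_subst_sum: "lin F (subst_sum v S T \<phi>) = subst_sum v S T (\<lambda>U. lin F (\<phi> U))"
proof -
  \<comment> \<open>A linear map on values becomes a functional on functions of one point.\<close>
  have "additive_functional (\<lambda>\<psi>. lin F (\<psi> ()))"
    by (simp add: additive_functional_def lin_add)
  from subst_sum_swap[OF this, of v S T "\<lambda>U _. \<phi> U"] show ?thesis by simp
qed

text \<open>Here summation over the terms of \<open>x\<close> is the additive functional, whereas in
  \<open>lin_subst_sum\<close> it is a linear map applied to the values.\<close>

lemma subst_sum_lin:
  "subst_sum v S T (\<lambda>U. lin (\<lambda>R. \<phi> U R) x) = lin (\<lambda>R. subst_sum v S T (\<lambda>U. \<phi> U R)) x"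
proof -
  have "additive_functional (\<lambda>\<psi>. lin \<psi> x)"
    by (simp add: additive_functional_def lin_add_fun)
  from subst_sum_swap[OF this] show ?thesis .
qed

section \<open>The spaces of labelled trees\<close>

lemma subspace_PRT: "pscale.subspace (PRT A :: ('u prt \<Rightarrow>\<^sub>0 'k::field) set)"
  unfolding pscale.subspace_def PRT_def
  using keys_add keys_pscale by fastforce

lemma basis_in_PRT: "labelled_by T A \<Longrightarrow> Poly_Mapping.single T c \<in> PRT A"
  by (simp add: PRT_def)

lemma lin_in_PRT:
  "(\<And>t. t \<in> Poly_Mapping.keys x \<Longrightarrow> F t \<in> PRT A) \<Longrightarrow> lin F x \<in> PRT A"
  unfolding lin_def
  by (intro pscale.subspace_sum[OF subspace_PRT] pscale.subspace_scale[OF subspace_PRT])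

lemma labelled_byD:
  "labelled_by T A \<Longrightarrow> distinct (vertices T)" "labelled_by T A \<Longrightarrow> set (vertices T) = A"
  by (simp_all add: labelled_by_def)

lemma PRT_D: "x \<in> PRT A \<Longrightarrow> T \<in> Poly_Mapping.keys x \<Longrightarrow> labelled_by T A"
  by (simp add: PRT_def)

text \<open>From here on, each law of composition reduces to an identity of \<open>subst_sum\<close>
  on trees.\<close>

lemma diamond0_eq_lin:
  fixes x y :: "'u prt \<Rightarrow>\<^sub>0 'k::field"
  assumes "v \<in> A" "x \<in> PRT A" "y \<in> PRT B"
  shows "diamond0 A B v x y = lin (\<lambda>T. lin (\<lambda>S. subst_sum v S T basis) y) x"
proof -
  have "diamond0_tree v T S = (subst_sum v S T basis :: 'u prt \<Rightarrow>\<^sub>0 'k)"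
    if "T \<in> Poly_Mapping.keys x" "S \<in> Poly_Mapping.keys y" for T S
    unfolding diamond0_tree_def
    using labelled_byD[OF PRT_D[OF assms(2) that(1)]] labelled_byD[OF PRT_D[OF assms(3) that(2)]]
      assms(1)
    by (intro sum_incr_maps_eq_subst_sum) auto
  then show ?thesis
    by (simp add: diamond0_def lin_def pscale.scale_sum_right)
qed

section \<open>Closure and associativity of the composition\<close>

lemma diamond0_closed:
  assumes "composable A v B" "x \<in> PRT A" "y \<in> PRT B"
  shows "diamond0 A B v x y \<in> PRT (glue A v B)"
proof -
  have v: "v \<in> A" using assms(1) by (simp add: composable_def)
  have "subst_sum v S T basis \<in> PRT (glue A v B)"
    if "T \<in> Poly_Mapping.keys x" "S \<in> Poly_Mapping.keys y" for T S
  proof (rule subst_sum_closed)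
    note T = PRT_D[OF assms(2) that(1)] and S = PRT_D[OF assms(3) that(2)]
    show "distinct (vertices T)" "v \<in> set (vertices T)"
      using labelled_byD[OF T] v by auto
    show "basis U \<in> PRT (glue A v B)"
      if "mset (vertices U) + {#v#} = mset (vertices T) + mset (vertices S)" for U
      by (intro basis_in_PRT labelled_by_glue[OF assms(1) T S that])
  qed (rule pscale.subspace_add[OF subspace_PRT])
  then show ?thesis
    unfolding diamond0_eq_lin[OF v assms(2,3)] by (intro lin_in_PRT)
qed

lemma diamond0_nested:
  assumes AB: "composable A v B" and w: "w \<in> B" and ABC: "composable (glue A v B) w C"
    and abc: "a \<in> PRT A" "b \<in> PRT B" "c \<in> PRT C"
  shows "diamond0 (glue A v B) C w (diamond0 A B v a b) c =
    diamond0 A (glue B w C) v a (diamond0 B C w b c)"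
proof -
  have BC: "composable B w C"
    using AB ABC w by (auto simp: composable_def glue_def)
  \<comment> \<open>\<open>w\<close> may equal \<open>v\<close>; disjointness of
    \<open>A - {v}\<close> and \<open>B\<close> excludes the other labels of
    \<open>A\<close>.\<close>
  have vw: "v \<in> A" "w \<in> glue A v B" "w \<notin> A - {v}"
    using AB w by (auto simp: composable_def glue_def)
  have "diamond0 (glue A v B) C w (diamond0 A B v a b) c =
      lin (\<lambda>T. lin (\<lambda>S. lin (\<lambda>R. subst_sum v S T (\<lambda>U. subst_sum w R U basis)) c) b) a"
    unfolding diamond0_eq_lin[OF vw(2) diamond0_closed[OF AB abc(1,2)] abc(3)]
    by (simp add: diamond0_eq_lin[OF vw(1) abc(1,2)] lin_lin lin_subst_sum subst_sum_lin)
  also have "\<dots> =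
      lin (\<lambda>T. lin (\<lambda>S. lin (\<lambda>R. subst_sum w R S (\<lambda>X. subst_sum v X T basis)) c) b) a"
  proof (intro lin_cong subst_sum_nested)
    fix T S assume T: "T \<in> Poly_Mapping.keys a" and S: "S \<in> Poly_Mapping.keys b"
    show "distinct (vertices T)" "v \<in> set (vertices T)" "w \<notin> set (vertices T) - {v}"
      using labelled_byD[OF PRT_D[OF abc(1) T]] vw by auto
    show "distinct (vertices S)" "w \<in> set (vertices S)"
      using labelled_byD[OF PRT_D[OF abc(2) S]] w by auto
  qed
  also have "\<dots> = diamond0 A (glue B w C) v a (diamond0 B C w b c)"
    unfolding diamond0_eq_lin[OF vw(1) abc(1) diamond0_closed[OF BC abc(2,3)]]
    by (simp add: diamond0_eq_lin[OF w abc(2,3)] lin_lin lin_subst_sum)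
  finally show ?thesis .
qed

lemma diamond0_disjoint:
  assumes AB: "composable A v B" and AC: "composable A w C" and ne: "v \<noteq> w" "B \<inter> C = {}"
    and abc: "a \<in> PRT A" "b \<in> PRT B" "c \<in> PRT C"
  shows "diamond0 (glue A v B) C w (diamond0 A B v a b) c =
    diamond0 (glue A w C) B v (diamond0 A C w a c) b"
proof -
  \<comment> \<open>As \<open>v\<close> and \<open>w\<close> differ, \<open>v\<close> lies in
    \<open>A - {w}\<close>, which is disjoint from \<open>C\<close>; symmetrically \<open>w\<close>
    is not in \<open>B\<close>.\<close>
  have vw: "v \<in> A" "w \<in> A" "w \<in> glue A v B" "v \<in> glue A w C" "w \<notin> B" "v \<notin> C"
    using AB AC ne by (auto simp: composable_def glue_def)
  have "diamond0 (glue A v B) C w (diamond0 A B v a b) c =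
      lin (\<lambda>T. lin (\<lambda>S. lin (\<lambda>R. subst_sum v S T (\<lambda>U. subst_sum w R U basis)) c) b) a"
    unfolding diamond0_eq_lin[OF vw(3) diamond0_closed[OF AB abc(1,2)] abc(3)]
    by (simp add: diamond0_eq_lin[OF vw(1) abc(1,2)] lin_lin lin_subst_sum subst_sum_lin)
  also have "\<dots> =
      lin (\<lambda>T. lin (\<lambda>S. lin (\<lambda>R. subst_sum w R T (\<lambda>U. subst_sum v S U basis)) c) b) a"
  proof (intro lin_cong subst_sum_disjoint ne(1))
    fix S R assume S: "S \<in> Poly_Mapping.keys b" and R: "R \<in> Poly_Mapping.keys c"
    show "w \<notin> set (vertices S)" "v \<notin> set (vertices R)"
      using labelled_byD[OF PRT_D[OF abc(2) S]] labelled_byD[OF PRT_D[OF abc(3) R]] vw by auto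
  qed
  \<comment> \<open>The two sides of the law sum over \<open>b\<close> and \<open>c\<close> in
    opposite orders.\<close>
  also have "\<dots> =
      lin (\<lambda>T. lin (\<lambda>R. lin (\<lambda>S. subst_sum w R T (\<lambda>U. subst_sum v S U basis)) b) c) a"
    by (intro lin_cong lin_swap)
  also have "\<dots> = diamond0 (glue A w C) B v (diamond0 A C w a c) b"
    unfolding diamond0_eq_lin[OF vw(4) diamond0_closed[OF AC abc(1,3)] abc(2)]
    by (simp add: diamond0_eq_lin[OF vw(2) abc(1,3)] lin_lin lin_subst_sum subst_sum_lin)
  finally show ?thesis .
qed

section \<open>Relabelling and equivariance\<close>

lemma relabel_PRT_eq_lin: "relabel_PRT A \<sigma> x = lin (\<lambda>T. basis (map_prt \<sigma> T)) x"
  by (simp add: relabel_PRT_def lin_def)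

lemma labelled_by_map_prt:
  "bij_betw \<sigma> A A' \<Longrightarrow> labelled_by T A \<Longrightarrow> labelled_by (map_prt \<sigma> T) A'"
  by (auto simp: labelled_by_def bij_betw_def distinct_map)

lemma relabel_PRT_closed:
  "bij_betw \<sigma> A A' \<Longrightarrow> x \<in> PRT A \<Longrightarrow> relabel_PRT A \<sigma> x \<in> PRT A'"
  unfolding relabel_PRT_eq_lin
  by (intro lin_in_PRT basis_in_PRT labelled_by_map_prt PRT_D)

lemma relabel_PRT_cong:
  assumes "\<And>a. a \<in> A \<Longrightarrow> \<sigma> a = \<tau> a" "x \<in> PRT A"
  shows "relabel_PRT A \<sigma> x = relabel_PRT A \<tau> x"
  unfolding relabel_PRT_eq_lin
  using map_prt_cong_vertices[of _ \<sigma> \<tau>] assms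
  by (intro lin_cong) (metis PRT_D labelled_byD(2))

lemma diamond0_equivariant:
  assumes AB: "composable A v B" and bij: "bij_betw \<sigma> A A'" "bij_betw \<tau> B B'"
    and AB': "composable A' (\<sigma> v) B'" and ab: "a \<in> PRT A" "b \<in> PRT B"
  shows "diamond0 A' B' (\<sigma> v) (relabel_PRT A \<sigma> a) (relabel_PRT B \<tau> b) =
    relabel_PRT (glue A v B) (\<lambda>x. if x \<in> B then \<tau> x else \<sigma> x) (diamond0 A B v a b)"
    (is "_ = relabel_PRT _ ?\<rho> _")
proof -
  have v: "v \<in> A" "\<sigma> v \<in> A'"
    using AB AB' by (auto simp: composable_def)
  have "diamond0 A' B' (\<sigma> v) (relabel_PRT A \<sigma> a) (relabel_PRT B \<tau> b) =
      lin (\<lambda>T. lin (\<lambda>S. subst_sum (\<sigma> v) (map_prt \<tau> S) (map_prt \<sigma> T) basis) b) a"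
    unfolding diamond0_eq_lin[OF v(2) relabel_PRT_closed[OF bij(1) ab(1)]
        relabel_PRT_closed[OF bij(2) ab(2)]]
    by (simp add: relabel_PRT_eq_lin lin_lin)
  also have "\<dots> = lin (\<lambda>T. lin (\<lambda>S. subst_sum v S T (\<lambda>U. basis (map_prt ?\<rho> U))) b) a"
  proof (intro lin_cong)
    fix T S assume T: "T \<in> Poly_Mapping.keys a" and S: "S \<in> Poly_Mapping.keys b"
    note T = labelled_byD[OF PRT_D[OF ab(1) T]] and S = labelled_byD[OF PRT_D[OF ab(2) S]]
    have "inj_on \<sigma> (set (vertices T))" "(set (vertices T) - {v}) \<inter> set (vertices S) = {}"
      using bij(1) AB T(2) S(2) by (auto simp: bij_betw_def composable_def)
    from subst_sum_map_prt[OF T(1) _ this] v(1)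
    show "subst_sum (\<sigma> v) (map_prt \<tau> S) (map_prt \<sigma> T) basis =
        subst_sum v S T (\<lambda>U. basis (map_prt ?\<rho> U))"
      by (simp add: T(2) S(2))
  qed
  also have "\<dots> = relabel_PRT (glue A v B) ?\<rho> (diamond0 A B v a b)"
    by (simp add: diamond0_eq_lin[OF v(1) ab] relabel_PRT_eq_lin lin_lin lin_subst_sum)
  finally show ?thesis .
qed

section \<open>The unit and the operad structure\<close>

lemma single_vertex_in_PRT: "single_vertex u \<in> PRT {u}"
  unfolding single_vertex_def by (rule basis_in_PRT) (simp add: labelled_by_def)

theorem proposition2:
  shows "species_operad
    (pscale :: 'k::field_char_0 \<Rightarrow> ('u prt \<Rightarrow>\<^sub>0 'k) \<Rightarrow> ('u prt \<Rightarrow>\<^sub>0 'k))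
    (PRT :: 'u set \<Rightarrow> ('u prt \<Rightarrow>\<^sub>0 'k) set)
    relabel_PRT
    diamond0
    single_vertex"
proof unfold_locales
  fix A B :: "'u set" and v and a a' b b' :: "'u prt \<Rightarrow>\<^sub>0 'k" and k :: 'k
  assume "composable A v B"
  then have v: "v \<in> A" by (simp add: composable_def)
  assume a: "a \<in> PRT A" and b: "b \<in> PRT B"
  \<comment> \<open>This rewriting holds only inside the spaces \<open>PRT\<close>, so each scaled
    or added argument is first shown to lie there.\<close>
  note eq = diamond0_eq_lin[OF v]
  show "diamond0 A B v (pscale k a) b = pscale k (diamond0 A B v a b)"
    using pscale.subspace_scale[OF subspace_PRT a, of k] a b by (simp add: eq lin_pscale)
  show "diamond0 A B v a (pscale k b) = pscale k (diamond0 A B v a b)"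
    using pscale.subspace_scale[OF subspace_PRT b, of k] a b
    by (simp add: eq lin_pscale lin_pscale_fun)
  show "diamond0 A B v (a + a') b = diamond0 A B v a b + diamond0 A B v a' b" if "a' \<in> PRT A"
    using pscale.subspace_add[OF subspace_PRT a that] a b that by (simp add: eq lin_add)
  show "diamond0 A B v a (b + b') = diamond0 A B v a b + diamond0 A B v a b'" if "b' \<in> PRT B"
    using pscale.subspace_add[OF subspace_PRT b that] a b that
    by (simp add: eq lin_add lin_add_fun)
next
  fix A A' :: "'u set" and \<sigma> \<tau> :: "'u \<Rightarrow> 'u" and x y :: "'u prt \<Rightarrow>\<^sub>0 'k" and k :: 'k and u
  show "relabel_PRT A \<sigma> (x + y) = relabel_PRT A \<sigma> x + relabel_PRT A \<sigma> y"
    by (simp add: relabel_PRT_eq_lin lin_add)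
  show "relabel_PRT A \<sigma> (pscale k x) = pscale k (relabel_PRT A \<sigma> x)"
    by (simp add: relabel_PRT_eq_lin lin_pscale)
  show "relabel_PRT {u} \<sigma> (single_vertex u) = (single_vertex (\<sigma> u) :: 'u prt \<Rightarrow>\<^sub>0 'k)"
    by (simp add: relabel_PRT_eq_lin single_vertex_def)
  show "relabel_PRT A id x = x"
    by (simp add: relabel_PRT_eq_lin prt.map_id lin_basis)
  show "relabel_PRT A (\<tau> \<circ> \<sigma>) x = relabel_PRT A' \<tau> (relabel_PRT A \<sigma> x)"
    by (simp add: relabel_PRT_eq_lin lin_lin prt.map_comp)
next
  fix B :: "'u set" and v and b :: "'u prt \<Rightarrow>\<^sub>0 'k"
  assume "b \<in> PRT B"
  \<comment> \<open>The root \<open>v\<close> has no branches, so the shuffle leaves each tree of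
    \<open>b\<close> as it is.\<close>
  then show "diamond0 {v} B v (single_vertex v) b = b"
    by (simp add: diamond0_eq_lin[OF _ single_vertex_in_PRT])
       (simp add: single_vertex_def lin_basis)
next
  fix A :: "'u set" and v w and a :: "'u prt \<Rightarrow>\<^sub>0 'k"
  assume "composable A v {w}" and a: "a \<in> PRT A"
  then have v: "v \<in> A" by (simp add: composable_def)
  have "diamond0 A {w} v a (single_vertex w) = lin (\<lambda>T. subst_sum v (B_plus w []) T basis) a"
    by (simp add: diamond0_eq_lin[OF v a single_vertex_in_PRT]) (simp add: single_vertex_def)
  also have "\<dots> = relabel_PRT A (id(v := w)) a"
    unfolding relabel_PRT_eq_lin
    using labelled_byD[OF PRT_D[OF a]] v
    by (intro lin_cong subst_sum_single_vertex_right) auto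
  finally show "diamond0 A {w} v a (single_vertex w) = relabel_PRT A (id(v := w)) a" .
qed (auto intro: subspace_PRT relabel_PRT_closed relabel_PRT_cong diamond0_closed
    diamond0_nested diamond0_disjoint single_vertex_in_PRT diamond0_equivariant)

end
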